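(* Let $m\ge 1$ be an integer, let $E_1,\dots,E_m,F$ be Banach spaces over $\mathbb{K}=\mathbb{R}$ or $\mathbb{C}$, and let $1\le s\le t<\infty$. Suppose that $\mathcal{L}(E_1,\dots,E_m;F)=\Pi^{mult}_{(t,s)}(E_1,\dots,E_m;F)$, i.e. every continuous $m$-linear operator $E_1\times\cdots\times E_m\to F$ is multiple $(t,s)$-summing. Then for real numbers $p,q$: (a) If $0<p\le t$ and $0<s\le q$, then $\eta^{m-mult}_{(p,q)}(E_1,\dots,E_m;F)\le \frac{m}{p}-\frac{m}{t}+\frac{m}{s}-\frac{m}{q}$. (b) If $0<p\le t$ and $0<q\le s$, then $\eta^{m-mult}_{(p,q)}(E_1,\dots,E_m;F)\le \frac{m}{p}-\frac{m}{t}$. (c) If $0<t\le p$ and $0<s\le q$, then $\eta^{m-mult}_{(p,q)}(E_1,\dots,E_m;F)\le \frac{m}{s}-\frac{m}{q}$. (d) If $0<t\le p$ and $0<q\le s$, then $\eta^{m-mult}_{(p,q)}(E_1,\dots,E_m;F)=0$.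
   Context: $\mathcal{L}(E_1,\dots,E_m;F)$ is the space of continuous $m$-linear operators $E_1\times\cdots\times E_m\to F$. For $0<q<\infty$ and $x_1,\dots,x_n$ in a Banach space $E$, put $\|(x_k)_{k=1}^n\|_{w,q}=\sup_{\varphi\in B_{E^*}}\big(\sum_{k=1}^n|\varphi(x_k)|^q\big)^{1/q}$, where $B_{E^*}$ is the closed unit ball of the dual $E^*$. For $1\le s\le t<\infty$, $T\in\mathcal{L}(E_1,\dots,E_m;F)$ is multiple $(t,s)$-summing if there is $C\ge0$ with $$\Big(\sum_{k_1,\dots,k_m=1}^n\|T(x^{(1)}_{k_1},\dots,x^{(m)}_{k_m})\|^t\Big)^{1/t}\le C\prod_{i=1}^m\|(x^{(i)}_{k})_{k=1}^n\|_{w,s}$$ for all positive integers $n$ and all $x^{(i)}_k\in E_i$, $1\le k\le n$, $1\le i\le m$. The set of these operators is $\Pi^{mult}_{(t,s)}(E_1,\dots,E_m;F)$. For $0<p,q<\infty$, the multilinear $m$-index of $(p,q)$-summability $\eta^{m-mult}_{(p,q)}(E_1,\dots,E_m;F)$ is the infimum of all $\sigma\ge0$ such that for every $T\in\mathcal{L}(E_1,\dots,E_m;F)$ there is a constant $C\ge0$ (not depending on $n$ or on the vectors) with $$\Big(\sum_{k_1,\dots,k_m=1}^n\|T(x^{(1)}_{k_1},\dots,x^{(m)}_{k_m})\|^p\Big)^{1/p}\le C\,n^{\sigma}\prod_{i=1}^m\|(x^{(i)}_{k})_{k=1}^n\|_{w,q}$$ for all positive integers $n$ and all $x^{(i)}_k\in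 E_i$, $1\le k\le n$, $1\le i\le m$. *)

theory Defs
  imports "HOL-Analysis.Analysis" "HOL-Algebra.Module"
begin

text \<open>
  The spaces \<open>E\<^sub>1, \<dots>, E\<^sub>m\<close> are different spaces and \<open>m\<close> is arbitrary, so they cannot all be
  types of class \<^class>\<open>banach\<close> (which moreover only has real scalars).  A Banach space is
  therefore a record with an explicit carrier: a module in the sense of HOL-Algebra together with
  a norm.  A family of spaces with carriers in one type \<open>'a\<close> is no restriction, since \<open>'a\<close> may be
  taken to be a disjoint union.  The fields \<open>mult\<close> and \<open>one\<close>, which the record of modules inherits
  from that of rings, play no role.

  The scalar field \<open>K\<close> is a type of class \<^class>\<open>real_normed_field\<close>: the instances include
  \<^typ>\<open>real\<close> and \<^typ>\<open>complex\<close>, and these are, by the theorem of Mazur and Ostrowski, the only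
  ones up to isometric isomorphism.
\<close>

definition scalars :: "'k::real_normed_field ring" where
  "scalars = \<lparr>carrier = UNIV, monoid.mult = (*), one = 1, zero = 0, add = (+)\<rparr>"

record ('k, 'a) normed_module = "('k, 'a) module" +
  vnorm :: "'a \<Rightarrow> real"

definition vdist :: "('k, 'a) normed_module \<Rightarrow> 'a \<Rightarrow> 'a \<Rightarrow> real" where
  "vdist E x y = vnorm E (x \<ominus>\<^bsub>E\<^esub> y)"

definition vtopology :: "('k, 'a) normed_module \<Rightarrow> 'a topology" where
  "vtopology E = Metric_space.mtopology (carrier E) (vdist E)"

definition normed_space :: "('k::real_normed_field, 'a) normed_module \<Rightarrow> bool" where
  "normed_space E \<longleftrightarrow>
     Module.module scalars E \<and>
     (\<forall>x\<in>carrier E. 0 \<le> vnorm E x) \<and>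
     (\<forall>x\<in>carrier E. vnorm E x = 0 \<longleftrightarrow> x = \<zero>\<^bsub>E\<^esub>) \<and>
     (\<forall>a. \<forall>x\<in>carrier E. vnorm E (a \<odot>\<^bsub>E\<^esub> x) = norm a * vnorm E x) \<and>
     (\<forall>x\<in>carrier E. \<forall>y\<in>carrier E. vnorm E (x \<oplus>\<^bsub>E\<^esub> y) \<le> vnorm E x + vnorm E y)"

definition banach_space :: "('k::real_normed_field, 'a) normed_module \<Rightarrow> bool" where
  "banach_space E \<longleftrightarrow> normed_space E \<and> Metric_space.mcomplete (carrier E) (vdist E)"

definition dual :: "('k::real_normed_field, 'a) normed_module \<Rightarrow> ('a \<Rightarrow> 'k) set" where
  "dual E = {\<phi> \<in> extensional (carrier E).
     (\<forall>x\<in>carrier E. \<forall>y\<in>carrier E. \<phi> (x \<oplus>\<^bsub>E\<^esub> y) = \<phi> x + \<phi> y) \<and>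
     (\<forall>a. \<forall>x\<in>carrier E. \<phi> (a \<odot>\<^bsub>E\<^esub> x) = a * \<phi> x) \<and>
     continuous_map (vtopology E) euclidean \<phi>}"

definition dual_norm :: "('k::real_normed_field, 'a) normed_module \<Rightarrow> ('a \<Rightarrow> 'k) \<Rightarrow> real" where
  "dual_norm E \<phi> = (SUP x\<in>{x \<in> carrier E. vnorm E x \<le> 1}. norm (\<phi> x))"

definition dual_ball :: "('k::real_normed_field, 'a) normed_module \<Rightarrow> ('a \<Rightarrow> 'k) set" where
  "dual_ball E = {\<phi> \<in> dual E. dual_norm E \<phi> \<le> 1}"

definition weak_norm ::
    "('k::real_normed_field, 'a) normed_module \<Rightarrow> real \<Rightarrow> nat \<Rightarrow> (nat \<Rightarrow> 'a) \<Rightarrow> real" where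
  "weak_norm E q n x = (SUP \<phi>\<in>dual_ball E. (\<Sum>k=1..n. norm (\<phi> (x k)) powr q) powr (1 / q))"

text \<open>
  An element of \<open>E\<^sub>1 \<times> \<dots> \<times> E\<^sub>m\<close> is a function in the extensional product over \<open>{1..m}\<close>.
\<close>

abbreviation tuples :: "nat \<Rightarrow> (nat \<Rightarrow> ('k, 'a) normed_module) \<Rightarrow> (nat \<Rightarrow> 'a) set" where
  "tuples m E \<equiv> (\<Pi>\<^sub>E i\<in>{1..m}. carrier (E i))"

definition multilinear_operators ::
    "nat \<Rightarrow> (nat \<Rightarrow> ('k::real_normed_field, 'a) normed_module) \<Rightarrow> ('k, 'b) normed_module
      \<Rightarrow> ((nat \<Rightarrow> 'a) \<Rightarrow> 'b) set" where
  "multilinear_operators m E F = {T \<in> tuples m E \<rightarrow>\<^sub>E carrier F.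
     (\<forall>x\<in>tuples m E. \<forall>i\<in>{1..m}. \<forall>u\<in>carrier (E i). \<forall>v\<in>carrier (E i).
        T (x(i := u \<oplus>\<^bsub>E i\<^esub> v)) = T (x(i := u)) \<oplus>\<^bsub>F\<^esub> T (x(i := v))) \<and>
     (\<forall>x\<in>tuples m E. \<forall>i\<in>{1..m}. \<forall>a. \<forall>u\<in>carrier (E i).
        T (x(i := a \<odot>\<^bsub>E i\<^esub> u)) = a \<odot>\<^bsub>F\<^esub> T (x(i := u))) \<and>
     continuous_map (product_topology (\<lambda>i. vtopology (E i)) {1..m}) (vtopology F) T}"

text \<open>
  \<open>x i k\<close> stands for \<open>x\<^sub>k\<^sup>(\<^sup>i\<^sup>)\<close>; a multi-index \<open>(k\<^sub>1, \<dots>, k\<^sub>m)\<close> is a function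
  \<open>k \<in> {1..m} \<rightarrow>\<^sub>E {1..n}\<close>.
\<close>

definition multi_sum ::
    "nat \<Rightarrow> ('k, 'b) normed_module \<Rightarrow> ((nat \<Rightarrow> 'a) \<Rightarrow> 'b) \<Rightarrow> real \<Rightarrow> nat \<Rightarrow> (nat \<Rightarrow> nat \<Rightarrow> 'a) \<Rightarrow> real"
    where
  "multi_sum m F T p n x =
     (\<Sum>k\<in>{1..m} \<rightarrow>\<^sub>E {1..n}. vnorm F (T (\<lambda>i\<in>{1..m}. x i (k i))) powr p) powr (1 / p)"

definition mult_summing_operators ::
    "real \<Rightarrow> real \<Rightarrow> nat \<Rightarrow> (nat \<Rightarrow> ('k::real_normed_field, 'a) normed_module)
      \<Rightarrow> ('k, 'b) normed_module \<Rightarrow> ((nat \<Rightarrow> 'a) \<Rightarrow> 'b) set" where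
  "mult_summing_operators t s m E F = {T \<in> multilinear_operators m E F.
     \<exists>C\<ge>0. \<forall>n\<ge>1. \<forall>x. (\<forall>i\<in>{1..m}. \<forall>k\<in>{1..n}. x i k \<in> carrier (E i)) \<longrightarrow>
       multi_sum m F T t n x \<le> C * (\<Prod>i=1..m. weak_norm (E i) s n (x i))}"

text \<open>
  The index is an extended real, so that the infimum of the empty set is \<open>\<infinity>\<close>.
\<close>

definition mult_index ::
    "real \<Rightarrow> real \<Rightarrow> nat \<Rightarrow> (nat \<Rightarrow> ('k::real_normed_field, 'a) normed_module)
      \<Rightarrow> ('k, 'b) normed_module \<Rightarrow> ereal" where
  "mult_index p q m E F = (INF \<sigma>\<in>{\<sigma>::real. 0 \<le> \<sigma> \<and> (\<forall>T\<in>multilinear_operators m E F.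
     \<exists>C\<ge>0. \<forall>n\<ge>1. \<forall>x. (\<forall>i\<in>{1..m}. \<forall>k\<in>{1..n}. x i k \<in> carrier (E i)) \<longrightarrow>
       multi_sum m F T p n x \<le> C * real n powr \<sigma> * (\<Prod>i=1..m. weak_norm (E i) q n (x i)))}.
     ereal \<sigma>)"

end

theory Submission imports Defs begin

text \<open>
  On finite families \<open>\<ell>\<^sub>p\<close> and \<open>\<ell>\<^sub>q\<close> quasi-norms are comparable, with constant
  \<open>N powr max 0 (1/p - 1/q)\<close> for \<open>N\<close> entries.  Applied to the \<open>n ^ m\<close> values of the operator this
  passes from exponent \<open>t\<close> to \<open>p\<close>, and applied to the \<open>n\<close> values of a functional it compares the
  weak norms with exponents \<open>s\<close> and \<open>q\<close>.  The four cases are the four ways of evaluating the maxima.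

  The field \<^const>\<open>vnorm\<close> is arbitrary outside the carrier, so \<^const>\<open>vdist\<close> need not satisfy
  \<^const>\<open>Metric_space\<close>, whose axioms demand nonnegativity and symmetry everywhere, and the library
  lemmas about continuity are not available.  The proof therefore does not use boundedness of the
  functionals: on \<^typ>\<open>real\<close> the supremum of an empty or unbounded set is an unspecified number,
  possibly negative, but always the same one for either exponent.
\<close>

section \<open>Comparison of quasi-norms on finite families\<close>

definition lp_norm :: "real \<Rightarrow> 'i set \<Rightarrow> ('i \<Rightarrow> real) \<Rightarrow> real" where
  "lp_norm p A a = (\<Sum>i\<in>A. a i powr p) powr (1 / p)"

lemma lp_norm_nonneg: "0 \<le> lp_norm p A a"
  by (simp add: lp_norm_def)

text \<open>Each entry is at most S, the \<open>q\<close>-quasi-norm, so a^p = a^q a^(p-q) \<le> a^q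
  S^(p-q); summing over the family gives at most S^p.\<close>

lemma lp_norm_antimono:
  assumes "finite A" "\<And>i. i \<in> A \<Longrightarrow> 0 \<le> a i" "0 < q" "q \<le> p"
  shows "lp_norm p A a \<le> lp_norm q A a"
proof (cases "lp_norm q A a = 0")
  case True
  then have "\<forall>i\<in>A. a i = 0"
    using assms by (simp add: lp_norm_def sum_nonneg_eq_0_iff)
  then show ?thesis
    by (simp add: lp_norm_def)
next
  case False
  define S where "S = lp_norm q A a"
  have "0 < S"
    using False lp_norm_nonneg [of q A a] by (simp add: S_def)
  have Sq: "S powr q = (\<Sum>i\<in>A. a i powr q)"
    using assms by (simp add: S_def lp_norm_def powr_powr sum_nonneg)
  have le: "a i \<le> S" if "i \<in> A" for i
  proof -
    have "a i powr q \<le> S powr q"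
      unfolding Sq using assms that by (intro member_le_sum) auto
    then show ?thesis
      using \<open>0 < q\<close> \<open>0 < S\<close> assms(2) [OF that] by (meson powr_less_mono2 not_le less_imp_le)
  qed
  have "a i powr p \<le> a i powr q * S powr (p - q)" if "i \<in> A" for i
  proof -
    have "a i powr p = a i powr q * a i powr (p - q)"
      by (simp flip: powr_add)
    also have "\<dots> \<le> a i powr q * S powr (p - q)"
      using assms le that by (intro mult_left_mono powr_mono2) auto
    finally show ?thesis .
  qed
  then have "(\<Sum>i\<in>A. a i powr p) \<le> S powr q * S powr (p - q)"
    unfolding Sq sum_distrib_right by (rule sum_mono)
  also have "\<dots> = S powr p"
    by (simp flip: powr_add)
  finally have "lp_norm p A a \<le> (S powr p) powr (1 / p)"
    unfolding lp_norm_def using assms by (intro powr_mono2) (auto intro: sum_nonneg)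
  then show ?thesis
    using assms \<open>0 < S\<close> by (simp add: powr_powr S_def)
qed

text \<open>Jensen's inequality for the convex function x^(q/p), with equal weights 1/N at the
  points a^p, followed by taking the power 1/q.\<close>

lemma lp_norm_power_mean:
  assumes "finite A" "\<And>i. i \<in> A \<Longrightarrow> 0 \<le> a i" "0 < p" "p \<le> q"
  shows "lp_norm p A a \<le> card A powr (1 / p - 1 / q) * lp_norm q A a"
proof -
  \<comment> \<open>Convexity is used on the open half-line only, so zero entries are discarded
    first; they contribute nothing to either sum.\<close>
  define B where "B = {i \<in> A. 0 < a i}"
  define N where "N = real (card B)"
  have B: "finite B" "B \<subseteq> A" "\<And>i. i \<in> B \<Longrightarrow> 0 < a i"
    using assms by (auto simp: B_def)
  have sum_B: "(\<Sum>i\<in>A. a i powr r) = (\<Sum>i\<in>B. a i powr r)" for r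
    using assms B by (intro sum.mono_neutral_right) (auto simp: B_def order_less_le)
  show ?thesis
  proof (cases "B = {}")
    case True
    then show ?thesis
      by (simp add: lp_norm_def sum_B)
  next
    case False
    then have "0 < N"
      using B by (simp add: N_def card_gt_0_iff)
    have N_le: "N \<le> card A"
      unfolding N_def using assms B by (simp add: card_mono)
    define P where "P = (\<Sum>i\<in>B. a i powr p)"
    define Q where "Q = (\<Sum>i\<in>B. a i powr q)"
    have PQ: "0 \<le> P" "0 \<le> Q"
      by (auto simp: P_def Q_def intro: sum_nonneg)
    have nz: "a i \<noteq> 0" if "i \<in> B" for i
      using B(3) [OF that] by simp
    have cvx: "convex_on {0<..} (\<lambda>x::real. x powr (q / p))"
      using assms by (intro powr_convex) auto
    have "(\<Sum>i\<in>B. (1 / N) *\<^sub>R (a i powr p)) powr (q / p)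
        \<le> (\<Sum>i\<in>B. (1 / N) * (a i powr p) powr (q / p))"
      using B False \<open>0 < N\<close> by (intro convex_on_sum [OF _ _ cvx]) (auto simp: N_def nz)
    then have "(P / N) powr (q / p) \<le> Q / N"
      using assms by (simp add: P_def Q_def powr_powr sum_divide_distrib)
    then have "((P / N) powr (q / p)) powr (1 / q) \<le> (Q / N) powr (1 / q)"
      using assms by (intro powr_mono2) auto
    then have "P powr (1 / p) / N powr (1 / p) \<le> Q powr (1 / q) / N powr (1 / q)"
      using assms PQ \<open>0 < N\<close> by (simp add: powr_powr powr_divide)
    then have "P powr (1 / p) \<le> N powr (1 / p - 1 / q) * Q powr (1 / q)"
      using \<open>0 < N\<close> by (simp add: powr_diff field_simps)
    \<comment> \<open>The exponent is nonnegative because \<open>p \<le> q\<close>, so N may grow to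
      the size of the whole family.\<close>
    also have "\<dots> \<le> card A powr (1 / p - 1 / q) * Q powr (1 / q)"
      using assms N_le \<open>0 < N\<close>
      by (intro mult_right_mono powr_mono2) (auto simp: frac_le)
    finally show ?thesis
      by (simp add: lp_norm_def sum_B P_def Q_def)
  qed
qed

lemma lp_norm_le:
  assumes "finite A" "\<And>i. i \<in> A \<Longrightarrow> 0 \<le> a i" "0 < p" "0 < q"
  shows "lp_norm p A a \<le> card A powr max 0 (1 / p - 1 / q) * lp_norm q A a"
proof (cases "p \<le> q")
  case True
  then have "max 0 (1 / p - 1 / q) = 1 / p - 1 / q"
    using assms by (simp add: frac_le)
  then show ?thesis
    using lp_norm_power_mean [OF assms(1-3) True] by simp
next
  case False
  then have "1 / p \<le> 1 / q"
    using assms by (simp add: frac_le)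
  then have "max 0 (1 / p - 1 / q) = 0"
    by simp
  moreover have "lp_norm p A a \<le> lp_norm q A a"
    using assms False by (intro lp_norm_antimono) auto
  \<comment> \<open>For empty \<open>A\<close> the factor is \<open>0 powr 0 = 0\<close>, not 1, so
    both sides must be seen to vanish.\<close>
  moreover have "lp_norm q A a = 0" if "card A = 0"
    using that assms by (simp add: lp_norm_def)
  ultimately show ?thesis
    by (cases "card A = 0") auto
qed

section \<open>Suprema of comparable functions, including default values\<close>

lemma Sup_real_not_bdd_above:
  fixes X :: "real set"
  assumes "\<not> bdd_above X"
  shows "Sup X = (LEAST z. False)"
proof -
  have "(\<lambda>z. \<forall>x\<in>X. x \<le> z) = (\<lambda>z. False)"
    using assms by (auto simp: bdd_above_def fun_eq_iff)
  then show ?thesis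
    by (simp add: Sup_real_def)
qed

text \<open>The two-sided estimate makes \<open>f\<close> and \<open>g\<close> bounded together, so
  either both suprema are genuine or both are the same default value. Since that value may be
  negative, the estimate is stated for absolute values and the sign is tracked separately.\<close>

lemma SUP_comparable:
  fixes f g :: "'i \<Rightarrow> real"
  assumes nonneg: "\<And>i. i \<in> I \<Longrightarrow> 0 \<le> f i" "\<And>i. i \<in> I \<Longrightarrow> 0 \<le> g i"
    and le: "\<And>i. i \<in> I \<Longrightarrow> f i \<le> \<kappa> * g i" "\<And>i. i \<in> I \<Longrightarrow> g i \<le> \<kappa>' * f i"
    and \<kappa>: "1 \<le> \<kappa>" "1 \<le> \<kappa>'"
  shows "sgn (SUP i\<in>I. f i) = sgn (SUP i\<in>I. g i)"
    and "\<bar>SUP i\<in>I. f i\<bar> \<le> \<kappa> * \<bar>SUP i\<in>I. g i\<bar>"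
proof -
  have bdd: "bdd_above (h ` I)"
    if "bdd_above (h' ` I)" "\<And>i. i \<in> I \<Longrightarrow> h i \<le> c * h' i" "1 \<le> c"
    for h h' :: "'i \<Rightarrow> real" and c
  proof -
    from that(1) obtain K where "\<And>i. i \<in> I \<Longrightarrow> h' i \<le> K"
      by (auto simp: bdd_above_def)
    then show ?thesis
      using that by (intro bdd_aboveI2 [of _ _ "c * K"])
        (meson mult_left_mono order_trans zero_le_one)
  qed
  have iff: "bdd_above (f ` I) \<longleftrightarrow> bdd_above (g ` I)"
    using bdd [of g f \<kappa>] bdd [of f g \<kappa>'] le \<kappa> by auto
  have "sgn (SUP i\<in>I. f i) = sgn (SUP i\<in>I. g i) \<and>
      \<bar>SUP i\<in>I. f i\<bar> \<le> \<kappa> * \<bar>SUP i\<in>I. g i\<bar>"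
  proof (cases "I \<noteq> {} \<and> bdd_above (g ` I)")
    case False
    then have "(SUP i\<in>I. f i) = (SUP i\<in>I. g i)"
      using iff by (auto simp: Sup_real_not_bdd_above)
    \<comment> \<open>With equal suprema the estimate reduces to
      \<open>1 \<le> \<kappa>\<close>.\<close>
    moreover have "1 * \<bar>SUP i\<in>I. g i\<bar> \<le> \<kappa> * \<bar>SUP i\<in>I. g i\<bar>"
      using \<kappa> by (intro mult_right_mono) auto
    ultimately show ?thesis
      by simp
  next
    case True
    have SUP_le: "(SUP i\<in>I. h i) \<le> c * (SUP i\<in>I. h' i)"
      if "bdd_above (h' ` I)" "\<And>i. i \<in> I \<Longrightarrow> h i \<le> c * h' i" "1 \<le> c"
      for h h' :: "'i \<Rightarrow> real" and c
    proof (rule cSUP_least)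
      show "h i \<le> c * (SUP i\<in>I. h' i)" if "i \<in> I" for i
        using \<open>bdd_above (h' ` I)\<close> \<open>1 \<le> c\<close> that \<open>\<And>i. i \<in> I \<Longrightarrow> h i \<le> c * h' i\<close>
        by (meson cSUP_upper mult_left_mono order_trans zero_le_one)
    qed (use True in auto)
    have fg: "(SUP i\<in>I. f i) \<le> \<kappa> * (SUP i\<in>I. g i)"
      "(SUP i\<in>I. g i) \<le> \<kappa>' * (SUP i\<in>I. f i)"
      using SUP_le [of g f] SUP_le [of f g] True iff le \<kappa> by auto
    from True obtain j where "j \<in> I"
      by blast
    then have "0 \<le> (SUP i\<in>I. f i)" "0 \<le> (SUP i\<in>I. g i)"
      using True iff nonneg by (auto intro: cSUP_upper2)
    \<comment> \<open>Both suprema are nonnegative, so equality of signs means that they vanish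
      together.\<close>
    moreover from this have "(SUP i\<in>I. f i) = 0 \<longleftrightarrow> (SUP i\<in>I. g i) = 0"
      using fg by (metis antisym mult_zero_right)
    ultimately show ?thesis
      using fg by (auto simp: sgn_if)
  qed
  then show "sgn (SUP i\<in>I. f i) = sgn (SUP i\<in>I. g i)"
    and "\<bar>SUP i\<in>I. f i\<bar> \<le> \<kappa> * \<bar>SUP i\<in>I. g i\<bar>"
    by auto
qed

lemma real_sgn_prod: "sgn (\<Prod>i\<in>A. f i) = (\<Prod>i\<in>A. sgn (f i))" for f :: "'i \<Rightarrow> real"
  by (induction A rule: infinite_finite_induct) (simp_all add: sgn_mult)

section \<open>Weak norms, multiple sums and the index\<close>

lemma weak_norm_comparable:
  fixes E :: "('k::real_normed_field, 'a) normed_module"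
  assumes "0 < s" "0 < q" "1 \<le> n"
  shows "sgn (weak_norm E s n x) = sgn (weak_norm E q n x)"
    and "\<bar>weak_norm E s n x\<bar> \<le> n powr max 0 (1 / s - 1 / q) * \<bar>weak_norm E q n x\<bar>"
proof -
  define f where "f r \<phi> = lp_norm r {1..n} (\<lambda>k. norm (\<phi> (x k)))" for r and \<phi> :: "'a \<Rightarrow> 'k"
  have weak_norm: "weak_norm E r n x = (SUP \<phi>\<in>dual_ball E. f r \<phi>)" for r
    by (simp add: weak_norm_def f_def lp_norm_def)
  have le: "f r \<phi> \<le> n powr max 0 (1 / r - 1 / r') * f r' \<phi>" if "0 < r" "0 < r'" for r r'
    and \<phi> :: "'a \<Rightarrow> 'k"
    using lp_norm_le [of "{1..n}" "\<lambda>k. norm (\<phi> (x k))" r r'] that by (simp add: f_def)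
  have f_nonneg: "0 \<le> f r \<phi>" for r \<phi>
    by (simp add: f_def lp_norm_nonneg)
  have ge_1: "1 \<le> real n powr max 0 c" for c
    using assms by (simp add: ge_one_powr_ge_zero)
  show "sgn (weak_norm E s n x) = sgn (weak_norm E q n x)"
    and "\<bar>weak_norm E s n x\<bar> \<le> n powr max 0 (1 / s - 1 / q) * \<bar>weak_norm E q n x\<bar>"
    unfolding weak_norm
    by (rule SUP_comparable [of "dual_ball E" "f s" "f q",
          OF f_nonneg f_nonneg le [OF assms(1,2)] le [OF assms(2,1)] ge_1 ge_1])+
qed

lemma multi_sum_le:
  assumes F: "normed_space F" and T: "T \<in> multilinear_operators m E F"
    and x: "\<forall>i\<in>{1..m}. \<forall>k\<in>{1..n}. x i k \<in> carrier (E i)"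
    and n: "1 \<le> n" and "0 < p" "0 < t"
  shows "multi_sum m F T p n x \<le> n powr (m * max 0 (1 / p - 1 / t)) * multi_sum m F T t n x"
proof -
  define A where "A = {1..m} \<rightarrow>\<^sub>E {1..n}"
  have "finite A"
    by (auto simp: A_def intro: finite_PiE)
  \<comment> \<open>The norm is known to be nonnegative on the carrier only, so the values of
    \<open>T\<close> must be placed there.\<close>
  moreover have "0 \<le> vnorm F (T (\<lambda>i\<in>{1..m}. x i (k i)))" if "k \<in> A" for k
  proof -
    have "(\<lambda>i\<in>{1..m}. x i (k i)) \<in> tuples m E"
      using x that by (auto simp: A_def PiE_iff)
    moreover have "T \<in> tuples m E \<rightarrow>\<^sub>E carrier F"
      using T by (simp only: multilinear_operators_def mem_Collect_eq)
    ultimately have "T (\<lambda>i\<in>{1..m}. x i (k i)) \<in> carrier F"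
      by (rule PiE_mem [rotated])
    then show ?thesis
      using F by (simp add: normed_space_def)
  qed
  ultimately have "lp_norm p A (\<lambda>k. vnorm F (T (\<lambda>i\<in>{1..m}. x i (k i))))
      \<le> card A powr max 0 (1 / p - 1 / t) * lp_norm t A (\<lambda>k. vnorm F (T (\<lambda>i\<in>{1..m}. x i (k i))))"
    using assms by (intro lp_norm_le) auto
  moreover have "real (card A) = n powr m"
    using n by (simp add: A_def card_PiE powr_realpow)
  ultimately show ?thesis
    by (simp add: multi_sum_def lp_norm_def A_def powr_powr)
qed

text \<open>The first summand of \<open>\<sigma>\<close> is the cost of changing the exponent of the
  sum over \<open>n ^ m\<close> multi-indices, the second that of changing \<open>m\<close> weak
  norms.\<close>

lemma multi_sum_le_of_summing:
  assumes F: "normed_space F" and T: "T \<in> mult_summing_operators t s m E F"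
    and pos: "0 < p" "0 < q" "0 < s" "0 < t"
  defines "\<sigma> \<equiv> m * max 0 (1 / p - 1 / t) + m * max 0 (1 / s - 1 / q)"
  shows "\<exists>C\<ge>0. \<forall>n\<ge>1. \<forall>x. (\<forall>i\<in>{1..m}. \<forall>k\<in>{1..n}. x i k \<in> carrier (E i)) \<longrightarrow>
    multi_sum m F T p n x \<le> C * real n powr \<sigma> * (\<Prod>i=1..m. weak_norm (E i) q n (x i))"
proof -
  from T obtain C where C: "0 \<le> C" and summing:
    "\<And>n x. \<lbrakk>1 \<le> n; \<forall>i\<in>{1..m}. \<forall>k\<in>{1..n}. x i k \<in> carrier (E i)\<rbrakk> \<Longrightarrow>
       multi_sum m F T t n x \<le> C * (\<Prod>i=1..m. weak_norm (E i) s n (x i))"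
    by (auto simp: mult_summing_operators_def)
  have "multi_sum m F T p n x \<le> C * real n powr \<sigma> * (\<Prod>i=1..m. weak_norm (E i) q n (x i))"
    if n: "1 \<le> n" and x: "\<forall>i\<in>{1..m}. \<forall>k\<in>{1..n}. x i k \<in> carrier (E i)" for n x
  proof -
    define \<beta> where "\<beta> = max 0 (1 / s - 1 / q)"
    define Ws where "Ws = (\<Prod>i=1..m. weak_norm (E i) s n (x i))"
    define Wq where "Wq = (\<Prod>i=1..m. weak_norm (E i) q n (x i))"
    have sgn: "sgn Ws = sgn Wq"
      unfolding Ws_def Wq_def real_sgn_prod
      using pos n by (intro prod.cong refl weak_norm_comparable)
    have "\<bar>Ws\<bar> \<le> (\<Prod>i=1..m. n powr \<beta> * \<bar>weak_norm (E i) q n (x i)\<bar>)"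
      unfolding Ws_def abs_prod
      using pos n by (intro prod_mono) (auto simp: \<beta>_def intro: weak_norm_comparable)
    also have "\<dots> = n powr (m * \<beta>) * \<bar>Wq\<bar>"
      using n by (simp add: Wq_def prod.distrib abs_prod powr_powr mult.commute flip: powr_realpow)
    finally have abs: "\<bar>Ws\<bar> \<le> n powr (m * \<beta>) * \<bar>Wq\<bar>" .
    have T_le: "0 \<le> multi_sum m F T t n x" "multi_sum m F T t n x \<le> C * Ws"
      using summing [OF n x] by (auto simp: Ws_def multi_sum_def)
    have CW: "C * Ws \<le> C * (n powr (m * \<beta>) * Wq)"
    proof (cases "0 \<le> Ws")
      case True
      then have "0 \<le> Wq"
        using sgn by (metis sgn_1_neg sgn_neg not_le)
      then show ?thesis
        using abs True C by (intro mult_left_mono) auto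
    next
      case False
      \<comment> \<open>If the product of weak norms is a negative default,
        \<open>0 \<le> C * Ws\<close> leaves only this possibility.\<close>
      then have "C = 0"
        using T_le C by (smt (verit) mult_pos_neg)
      then show ?thesis
        by simp
    qed
    have "multi_sum m F T p n x \<le> n powr (m * max 0 (1 / p - 1 / t)) * multi_sum m F T t n x"
      using T F x n pos by (intro multi_sum_le) (auto simp: mult_summing_operators_def)
    also have "\<dots> \<le> n powr (m * max 0 (1 / p - 1 / t)) * (C * (n powr (m * \<beta>) * Wq))"
      using T_le CW by (intro mult_left_mono) auto
    also have "\<dots> = C * real n powr \<sigma> * Wq"
      by (simp add: \<sigma>_def \<beta>_def powr_add)
    finally show ?thesis
      by (simp add: Wq_def)
  qed
  with C show ?thesis
    by blast
qed

lemma mult_index_le: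
  assumes "normed_space F" "0 < p" "0 < q" "0 < s" "0 < t"
    and "multilinear_operators m E F = mult_summing_operators t s m E F"
  shows "mult_index p q m E F \<le> ereal (m * max 0 (1 / p - 1 / t) + m * max 0 (1 / s - 1 / q))"
  unfolding mult_index_def assms(6)
  by (intro INF_lower CollectI conjI ballI multi_sum_le_of_summing) (use assms in auto)

lemma mult_index_nonneg: "0 \<le> mult_index p q m E F"
  unfolding mult_index_def by (intro INF_greatest) auto

theorem proposition1p3:
  fixes m :: nat
    and E :: "nat \<Rightarrow> ('k::real_normed_field, 'a) normed_module"
    and F :: "('k, 'b) normed_module"
    and s t p q :: real
  assumes "1 \<le> m"
    and "\<And>i. i \<in> {1..m} \<Longrightarrow> banach_space (E i)"
    and "banach_space F"
    and "1 \<le> s" and "s \<le> t"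
    and "multilinear_operators m E F = mult_summing_operators t s m E F"
  shows "(0 < p \<and> p \<le> t \<and> 0 < s \<and> s \<le> q \<longrightarrow>
            mult_index p q m E F \<le> ereal (m / p - m / t + m / s - m / q)) \<and>
         (0 < p \<and> p \<le> t \<and> 0 < q \<and> q \<le> s \<longrightarrow>
            mult_index p q m E F \<le> ereal (m / p - m / t)) \<and>
         (0 < t \<and> t \<le> p \<and> 0 < s \<and> s \<le> q \<longrightarrow>
            mult_index p q m E F \<le> ereal (m / s - m / q)) \<and>
         (0 < t \<and> t \<le> p \<and> 0 < q \<and> q \<le> s \<longrightarrow>
            mult_index p q m E F = 0)"
proof -
  have max_le: "max 0 (1 / a - 1 / b) = 1 / a - 1 / b" if "0 < a" "a \<le> b" for a b :: real
    using that by (simp add: frac_le)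
  have max_ge: "max 0 (1 / a - 1 / b) = 0" if "0 < b" "b \<le> a" for a b :: real
    using frac_le [of 1 1 b a] that by simp
  have index: "mult_index p q m E F
      \<le> ereal (m * max 0 (1 / p - 1 / t) + m * max 0 (1 / s - 1 / q))" if "0 < p" "0 < q"
    using assms that by (intro mult_index_le) (auto simp: banach_space_def)
  show ?thesis
    \<comment> \<open>Positivity of \<open>p\<close> and \<open>q\<close> follows in each case from
      \<open>1 \<le> s \<le> t\<close>. In the last case both maxima vanish, and nonnegativity of
      the index gives equality.\<close>
    using index assms(4,5) mult_index_nonneg [of p q m E F]
    by (auto simp: max_le max_ge right_diff_distrib add_diff_eq intro!: antisym
        simp flip: zero_ereal_def)
qed

end
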